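(* Let $p\in(0,1)$, $q=1-p$, and let $m\ge 1$ be an integer. Define the $(m+1)\times(m+1)$ matrix $W_m=L_m+U_m$, with rows and columns indexed by $0\le i,j\le m$, where $$(L_m)_{ij}=\binom{i}{i-j}p^{i-j}q^{j+1},\qquad (U_m)_{ij}=\binom{m-i}{j-i}p^{m+1-j}q^{j-i},$$ with the convention that a binomial coefficient $\binom{a}{b}$ is $0$ when $b<0$ or $b>a$. Then $W_m$ is a regular doubly stochastic matrix.
   Context: A square matrix with nonnegative entries is doubly stochastic if every row sum and every column sum equals $1$. A stochastic matrix is regular if some power of it has all entries strictly positive. (The matrix $W_m$ is the matrix of the linear recurrence satisfied by the vector of mixed moments $(\mathbb E[X_n^{m}],\mathbb E[X_n^{m-1}Y_n],\dots,\mathbb E[Y_n^m])$ of the interval ends of arithmetic coding on i.i.d. Bernoulli$(p)$ bits.) *)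

theory Defs
  imports Complex_Main "Jordan_Normal_Form.Matrix"
begin

definition nonneg_square_mat :: "real mat \<Rightarrow> bool" where
  "nonneg_square_mat A \<longleftrightarrow>
     square_mat A \<and> (\<forall>i<dim_row A. \<forall>j<dim_col A. 0 \<le> A $$ (i, j))"

definition stochastic_mat :: "real mat \<Rightarrow> bool" where
  "stochastic_mat A \<longleftrightarrow>
     nonneg_square_mat A \<and> (\<forall>i<dim_row A. (\<Sum>j<dim_col A. A $$ (i, j)) = 1)"

definition doubly_stochastic_mat :: "real mat \<Rightarrow> bool" where
  "doubly_stochastic_mat A \<longleftrightarrow>
     nonneg_square_mat A \<and>
     (\<forall>i<dim_row A. (\<Sum>j<dim_col A. A $$ (i, j)) = 1) \<and>
     (\<forall>j<dim_col A. (\<Sum>i<dim_row A. A $$ (i, j)) = 1)"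

(* The exponent is required to be positive: the zeroth power is the identity. *)
definition regular_stochastic_mat :: "real mat \<Rightarrow> bool" where
  "regular_stochastic_mat A \<longleftrightarrow>
     stochastic_mat A \<and>
     (\<exists>k>0. \<forall>i<dim_row A. \<forall>j<dim_col A. 0 < (A ^\<^sub>m k) $$ (i, j))"

(* The guards implement the convention that a binomial coefficient with negative lower
   index is 0; they are needed because subtraction on nat truncates, so that for i < j
   the term i choose (i - j) would be 1. For indices at most m the lower index never
   exceeds the upper one, and all subtractions occurring under the guards are exact. *)
definition L_mat :: "nat \<Rightarrow> real \<Rightarrow> real \<Rightarrow> real mat" where
  "L_mat m p q = mat (m + 1) (m + 1) (\<lambda>(i, j).
     if j \<le> i then real (i choose (i - j)) * p ^ (i - j) * q ^ (j + 1) else 0)"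

definition U_mat :: "nat \<Rightarrow> real \<Rightarrow> real \<Rightarrow> real mat" where
  "U_mat m p q = mat (m + 1) (m + 1) (\<lambda>(i, j).
     if i \<le> j then real ((m - i) choose (j - i)) * p ^ (m + 1 - j) * q ^ (j - i) else 0)"

definition W_mat :: "nat \<Rightarrow> real \<Rightarrow> real \<Rightarrow> real mat" where
  "W_mat m p q = L_mat m p q + U_mat m p q"

end

theory Submission imports Defs begin

text \<open>
  The rows are binomial expansions of \<open>q (p + q)\<^sup>i\<close> and \<open>p (p + q)\<^sup>m\<^sup>-\<^sup>i\<close>. For the columns, in
  independent trials with success probability \<open>q\<close>, the lower triangular part of column \<open>j\<close> sums
  to the probability that the \<open>(j + 1)\<close>-st success precedes the \<open>(m - j + 1)\<close>-st failure, and
  the upper triangular part to the probability of the complementary event. Conditioning on the first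
  trial gives the recurrence behind the inductive proof of the resulting (Chaundy--Bullard) identity.
  All entries of the matrix are already positive, so its first power witnesses regularity.
\<close>

text \<open>When \<open>p + q = 1\<close> with \<open>p\<close> and \<open>q\<close> nonnegative,
  the summand at \<open>k\<close> is the negative binomial weight: exactly \<open>k\<close>
  failures, each of probability \<open>p\<close>, precede success number
  \<open>a + 1\<close>.\<close>

definition neg_binomial_sum :: "'a::comm_ring_1 \<Rightarrow> 'a \<Rightarrow> nat \<Rightarrow> nat \<Rightarrow> 'a" where
  "neg_binomial_sum p q a b = (\<Sum>k\<le>b. of_nat ((a + k) choose k) * p ^ k * q ^ (a + 1))"

lemma neg_binomial_sum_Suc_Suc:
  "neg_binomial_sum p q (Suc a) (Suc b) =
     q * neg_binomial_sum p q a (Suc b) + p * neg_binomial_sum p q (Suc a) b"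
proof -
  let ?f = "\<lambda>k. of_nat ((Suc a + k) choose k) * p ^ k * q ^ (a + 2)"
  let ?g = "\<lambda>k. of_nat ((a + k) choose k) * p ^ k * q ^ (a + 2)"
  \<comment> \<open>Pascal's rule. \<open>?g\<close> has the coefficients for \<open>a\<close> but
    keeps the power \<open>a + 2\<close>; the surplus factor \<open>q\<close> becomes the weight
    \<open>q\<close> of the recurrence.\<close>
  have pascal: "?f (Suc k) = ?g (Suc k) + p * ?f k" for k
    by (simp add: algebra_simps)
  have "neg_binomial_sum p q (Suc a) (Suc b) = (\<Sum>k\<le>Suc b. ?f k)"
    by (simp add: neg_binomial_sum_def)
  also have "\<dots> = ?f 0 + (\<Sum>k\<le>b. ?f (Suc k))"
    by (rule sum.atMost_Suc_shift)
  \<comment> \<open>\<open>?f 0\<close> and \<open>?g 0\<close> agree, since both coefficients are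
    1, so the \<open>?g\<close> sum can be closed up again.\<close>
  also have "\<dots> = (?g 0 + (\<Sum>k\<le>b. ?g (Suc k))) + p * (\<Sum>k\<le>b. ?f k)"
    by (simp only: pascal sum.distrib sum_distrib_left) simp
  also have "?g 0 + (\<Sum>k\<le>b. ?g (Suc k)) = (\<Sum>k\<le>Suc b. ?g k)"
    by (rule sum.atMost_Suc_shift [symmetric])
  also have "\<dots> = q * neg_binomial_sum p q a (Suc b)"
    unfolding neg_binomial_sum_def sum_distrib_left
    by (intro sum.cong) (simp_all add: algebra_simps)
  also have "(\<Sum>k\<le>b. ?f k) = neg_binomial_sum p q (Suc a) b"
    by (simp add: neg_binomial_sum_def)
  finally show ?thesis .
qed

lemma neg_binomial_sum_0_right: "neg_binomial_sum p q a 0 = q ^ (a + 1)"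
  by (simp add: neg_binomial_sum_def)

lemma neg_binomial_sum_0_left:
  assumes "p + q = 1"
  shows "neg_binomial_sum p q 0 b = 1 - p ^ (b + 1)"
proof -
  have "q = 1 - p" using assms by (simp add: algebra_simps)
  then have "neg_binomial_sum p q 0 b = (1 - p) * (\<Sum>k<Suc b. p ^ k)"
    by (simp add: neg_binomial_sum_def sum_distrib_left lessThan_Suc_atMost mult.commute)
  also have "\<dots> = 1 - p ^ (b + 1)"
    using one_diff_power_eq [of p "Suc b"] by simp
  finally show ?thesis .
qed

lemma Chaundy_Bullard:
  assumes "p + q = 1"
  shows "neg_binomial_sum p q a b + neg_binomial_sum q p b a = 1"
proof (induction "a + b" arbitrary: a b)
  case 0
  then show ?case using assms
    by (simp add: neg_binomial_sum_0_right add.commute)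
next
  case (Suc n)
  have sym: "q + p = 1" using assms by (simp add: add.commute)
  consider "a = 0" | "b = 0" | a' b' where "a = Suc a'" "b = Suc b'"
    by (cases a; cases b) auto
  then show ?case
  proof cases
    case 3
    let ?N = "neg_binomial_sum p q" and ?M = "neg_binomial_sum q p"
    have IH: "?N a' b + ?M b a' = 1" "?N a b' + ?M b' a = 1"
      using Suc 3 by auto
    \<comment> \<open>Since \<open>p\<close> and \<open>q\<close> are swapped in \<open>?M\<close>,
      its recurrence lowers \<open>a\<close> with weight \<open>q\<close> and \<open>b\<close> with
      weight \<open>p\<close>, just as for \<open>?N\<close>, and the terms pair up.\<close>
    have "?N a b + ?M b a = q * (?N a' b + ?M b a') + p * (?N a b' + ?M b' a)"
      by (simp add: 3 neg_binomial_sum_Suc_Suc algebra_simps)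
    then show ?thesis using sym IH by simp
  qed (simp_all add: neg_binomial_sum_0_right neg_binomial_sum_0_left assms sym)
qed

lemma dim_W_mat [simp]:
  "dim_row (W_mat m p q) = m + 1" "dim_col (W_mat m p q) = m + 1"
  by (simp_all add: W_mat_def L_mat_def U_mat_def)

lemma W_mat_index:
  assumes "i \<le> m" and "j \<le> m"
  shows "W_mat m p q $$ (i, j) =
    (if j \<le> i then real (i choose (i - j)) * p ^ (i - j) * q ^ (j + 1) else 0) +
    (if i \<le> j then real ((m - i) choose (j - i)) * p ^ (m + 1 - j) * q ^ (j - i) else 0)"
  using assms by (simp add: W_mat_def L_mat_def U_mat_def)

text \<open>At every position at least one guard holds, and on the diagonal both do. A guarded term
  is positive because its binomial coefficient is in range.\<close>

lemma W_mat_pos: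
  assumes "0 < p" "0 < q" "i \<le> m" "j \<le> m"
  shows "0 < W_mat m p q $$ (i, j)"
  using assms by (auto simp: W_mat_index intro!: add_pos_pos mult_pos_pos)

lemma W_mat_row_sum:
  assumes "p + q = 1" and "i \<le> m"
  shows "(\<Sum>j\<le>m. W_mat m p q $$ (i, j)) = 1"
proof -
  let ?L = "\<lambda>j. real (i choose (i - j)) * p ^ (i - j) * q ^ (j + 1)"
  let ?U = "\<lambda>j. real ((m - i) choose (j - i)) * p ^ (m + 1 - j) * q ^ (j - i)"
  have "(\<Sum>j\<le>m. if j \<le> i then ?L j else 0) = (\<Sum>j\<le>i. ?L j)"
    using assms(2) by (intro sum.mono_neutral_cong_right) auto
  also have "\<dots> = q * (\<Sum>j\<le>i. real (i choose j) * q ^ j * p ^ (i - j))"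
    unfolding sum_distrib_left
    by (intro sum.cong) (simp_all add: binomial_symmetric [symmetric] algebra_simps)
  also have "\<dots> = q * (q + p) ^ i"
    by (simp add: binomial_ring)
  finally have L: "(\<Sum>j\<le>m. if j \<le> i then ?L j else 0) = q"
    using assms(1) by (simp add: add.commute)
  have "(\<Sum>j\<le>m. if i \<le> j then ?U j else 0) = (\<Sum>j\<in>{i..m}. ?U j)"
    by (intro sum.mono_neutral_cong_right) auto
  also have "\<dots> = (\<Sum>k\<le>m - i. ?U (i + k))"
    using assms(2)
    by (intro sum.reindex_bij_witness [of _ "\<lambda>k. i + k" "\<lambda>j. j - i"]) auto
  \<comment> \<open>For \<open>k \<le> m - i\<close> the exponent \<open>m + 1 - (i + k)\<close>
    exceeds \<open>m - i - k\<close> by one, which frees the factor \<open>p\<close>.\<close>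
  also have "\<dots> = p * (\<Sum>k\<le>m - i. real ((m - i) choose k) * q ^ k * p ^ (m - i - k))"
    unfolding sum_distrib_left
    using assms(2) by (intro sum.cong) (simp_all add: Suc_diff_le)
  also have "\<dots> = p * (q + p) ^ (m - i)"
    by (simp add: binomial_ring)
  finally have U: "(\<Sum>j\<le>m. if i \<le> j then ?U j else 0) = p"
    using assms(1) by (simp add: add.commute)
  have "(\<Sum>j\<le>m. W_mat m p q $$ (i, j)) =
      (\<Sum>j\<le>m. if j \<le> i then ?L j else 0) + (\<Sum>j\<le>m. if i \<le> j then ?U j else 0)"
    unfolding sum.distrib [symmetric] using assms(2) by (intro sum.cong refl W_mat_index) auto
  then show ?thesis using L U assms(1) by simp
qed

text \<open>In a row the two triangular parts sum to \<open>q\<close> and \<open>p\<close>. In a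
  column each part is a truncated sum depending on \<open>j\<close>, so the Chaundy--Bullard
  identity is needed to add them.\<close>

lemma W_mat_col_sum:
  assumes "p + q = 1" and "j \<le> m"
  shows "(\<Sum>i\<le>m. W_mat m p q $$ (i, j)) = 1"
proof -
  let ?L = "\<lambda>i. real (i choose (i - j)) * p ^ (i - j) * q ^ (j + 1)"
  let ?U = "\<lambda>i. real ((m - i) choose (j - i)) * p ^ (m + 1 - j) * q ^ (j - i)"
  have "(\<Sum>i\<le>m. if j \<le> i then ?L i else 0) = (\<Sum>i\<in>{j..m}. ?L i)"
    by (intro sum.mono_neutral_cong_right) auto
  also have "\<dots> = neg_binomial_sum p q j (m - j)"
    unfolding neg_binomial_sum_def using assms(2)
    by (intro sum.reindex_bij_witness [of _ "\<lambda>k. j + k" "\<lambda>i. i - j"]) auto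
  finally have L: "(\<Sum>i\<le>m. if j \<le> i then ?L i else 0) = neg_binomial_sum p q j (m - j)" .
  have "(\<Sum>i\<le>m. if i \<le> j then ?U i else 0) = (\<Sum>i\<le>j. ?U i)"
    using assms(2) by (intro sum.mono_neutral_cong_right) auto
  \<comment> \<open>The column is read upwards from the diagonal: with \<open>i = j - k\<close> the
    upper index \<open>m - i\<close> becomes \<open>(m - j) + k\<close>.\<close>
  also have "\<dots> = neg_binomial_sum q p (m - j) j"
    unfolding neg_binomial_sum_def using assms(2)
    by (intro sum.reindex_bij_witness [of _ "\<lambda>k. j - k" "\<lambda>i. j - i"])
      (auto simp: Suc_diff_le mult_ac)
  finally have U: "(\<Sum>i\<le>m. if i \<le> j then ?U i else 0) = neg_binomial_sum q p (m - j) j" .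
  have "(\<Sum>i\<le>m. W_mat m p q $$ (i, j)) =
      (\<Sum>i\<le>m. if j \<le> i then ?L i else 0) + (\<Sum>i\<le>m. if i \<le> j then ?U i else 0)"
    unfolding sum.distrib [symmetric] using assms(2) by (intro sum.cong refl W_mat_index) auto
  then show ?thesis using L U Chaundy_Bullard [OF assms(1)] by simp
qed

theorem theorem1:
  fixes p q :: real and m :: nat
  assumes "0 < p" and "p < 1" and "q = 1 - p" and "m \<ge> 1"
  shows "doubly_stochastic_mat (W_mat m p q) \<and> regular_stochastic_mat (W_mat m p q)"
proof -
  let ?W = "W_mat m p q"
  have pq: "p + q = 1" "0 < q" using assms by auto
  have pos: "0 < ?W $$ (i, j)" if "i < m + 1" "j < m + 1" for i j
    using W_mat_pos [of p q i m j] assms(1) pq(2) that by simp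
  then have nonneg: "nonneg_square_mat ?W"
    by (auto simp: nonneg_square_mat_def intro: less_imp_le)
  have rows: "\<forall>i<m + 1. (\<Sum>j<m + 1. ?W $$ (i, j)) = 1"
    using W_mat_row_sum [OF pq(1)] by (simp add: lessThan_Suc_atMost less_Suc_eq_le)
  have cols: "\<forall>j<m + 1. (\<Sum>i<m + 1. ?W $$ (i, j)) = 1"
    using W_mat_col_sum [OF pq(1)] by (simp add: lessThan_Suc_atMost less_Suc_eq_le)
  have "?W ^\<^sub>m 1 = ?W"
    by (simp add: left_mult_one_mat [of _ "m + 1" "m + 1"] carrier_matI)
  then have "\<exists>k>0. \<forall>i<m + 1. \<forall>j<m + 1. 0 < (?W ^\<^sub>m k) $$ (i, j)"
    using pos by (intro exI [of _ 1]) simp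
  with nonneg rows cols show ?thesis
    by (simp add: doubly_stochastic_mat_def regular_stochastic_mat_def stochastic_mat_def)
qed

end
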